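(* Let $k>0$ be real, let $n$ be a positive integer, and let $a,b,\alpha_i,\beta_i$ ($i=1,\dots,n$) be real numbers such that $0<a\leq b$ and, for every $i\in\{1,\dots,n\}$, $\alpha_i>0$, $\beta_i>0$, and for all $t\in[0,\infty)$: $at+\alpha_i>0$, $bt+\beta_i>0$, $at+\alpha_i\leq bt+\beta_i$ and $\psi_k(at+\alpha_i)>0$. Define $$X(t)=\prod_{i=1}^{n}\frac{\Gamma_k(at+\alpha_i)}{\Gamma_k(bt+\beta_i)},\qquad t\in[0,\infty).$$ Then $X$ is decreasing (in the weak sense, i.e. non-increasing) on $[0,\infty)$, and for every $t\in[0,1]$, $$\prod_{i=1}^{n}\frac{\Gamma_k(a+\alpha_i)}{\Gamma_k(b+\beta_i)}\leq\prod_{i=1}^{n}\frac{\Gamma_k(at+\alpha_i)}{\Gamma_k(bt+\beta_i)}\leq\prod_{i=1}^{n}\frac{\Gamma_k(\alpha_i)}{\Gamma_k(\beta_i)}.$$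
   Context: For $k>0$ and $t>0$, the $k$-Gamma function is $\Gamma_k(t)=\int_0^\infty e^{-\frac{x^k}{k}}x^{t-1}\,dx$, and $\psi_k(t)=\frac{d}{dt}\ln\Gamma_k(t)=\Gamma_k'(t)/\Gamma_k(t)$ is the $k$-analogue of the psi function. *)

theory Defs
  imports "HOL-Analysis.Analysis"
begin

text \<open>
  The convention \<open>0 powr s = 0\<close> affects the integrand only at the single point \<open>x = 0\<close>,
  so the (Henstock-Kurzweil) integral over \<open>{0..}\<close> is the improper integral
  from \<open>0\<close> to \<open>\<infinity>\<close>. The definition is meaningful for \<open>k > 0\<close> and \<open>t > 0\<close>.
\<close>

definition k_Gamma :: "real \<Rightarrow> real \<Rightarrow> real" where
  "k_Gamma k t = integral {0..} (\<lambda>x. exp (- (x powr k / k)) * x powr (t - 1))"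

definition k_psi :: "real \<Rightarrow> real \<Rightarrow> real" where
  "k_psi k t = deriv (\<lambda>s. ln (k_Gamma k s)) t"

end

theory Submission
  imports Defs
begin

text \<open>
  The substitution \<open>u = x powr k / k\<close> gives \<open>\<Gamma>\<^sub>k(t) = k powr (t / k - 1) * \<Gamma>(t / k)\<close>, hence
  \<open>\<psi>\<^sub>k(t) = (ln k + \<psi>(t / k)) / k\<close>, where the digamma function \<open>\<psi>\<close> is increasing. The logarithmic
  derivative of each factor of \<open>X\<close> is \<open>a * \<psi>\<^sub>k(at + \<alpha>) - b * \<psi>\<^sub>k(bt + \<beta>)\<close>, which is nonpositive because
  \<open>0 < \<psi>\<^sub>k(at + \<alpha>) \<le> \<psi>\<^sub>k(bt + \<beta>)\<close> and \<open>0 < a \<le> b\<close>.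
\<close>

lemma k_Gamma_conv_Gamma:
  fixes k t :: real
  assumes k: "k > 0" and t: "t > 0"
  shows "k_Gamma k t = k powr (t / k - 1) * Gamma (t / k)"
proof -
  \<comment> \<open>\<open>?g\<close> is the substitution and \<open>?f\<close> the integrand of the
    Euler integral for \<open>Gamma (t / k)\<close>. The inverse of \<open>?g\<close> on the
    positive reals is \<open>y\<close> to \<open>(k * y) powr (1 / k)\<close>, which supplies the
    witness for surjectivity and the left inverse for injectivity.\<close>
  let ?g = "\<lambda>x::real. x powr k / k"
  let ?f = "\<lambda>u::real. u powr (t / k - 1) / exp u"
  have pos: "t / k > 0" using k t by simp
  have img: "?g ` {0<..} = {0<..}"
  proof (intro equalityI subsetI)
    fix y :: real assume "y \<in> {0<..}"
    then have "y = ?g ((k * y) powr (1 / k))" "(k * y) powr (1 / k) \<in> {0<..}"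
      using k by (auto simp: powr_powr)
    then show "y \<in> ?g ` {0<..}" by blast
  qed (use k in auto)
  have inj: "inj_on ?g {0<..}"
  proof (rule inj_on_inverseI)
    fix x :: real assume "x \<in> {0<..}"
    then show "(k * ?g x) powr (1 / k) = x" using k by (simp add: powr_powr)
  qed
  have deriv: "(?g has_field_derivative x powr (k - 1)) (at x within {0<..})" if "x \<in> {0<..}" for x
    using that k by (auto intro!: derivative_eq_intros)
  \<comment> \<open>At 0 the derivative formula \<open>x powr (k - 1)\<close> can fail (for instance
    if k < 1), so the substitution is made on the open half-line. The endpoint is a null set, so no
    integral changes.\<close>
  have int_open: "(h has_integral y) {0<..} \<longleftrightarrow> (h has_integral y) {0..}" for h :: "real \<Rightarrow> real" and y
    by (intro has_integral_spike_set_eq; rule negligible_subset[of "{0}"]) auto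
  have "(?f has_integral Gamma (t / k)) {0<..}"
    using Gamma_integral_real[OF pos] by (simp add: int_open)
  \<comment> \<open>The change of variables theorem speaks of absolute integrability, which comes
    for free here since \<open>?f\<close> is nonnegative.\<close>
  then have "?f absolutely_integrable_on {0<..} \<and> integral {0<..} ?f = Gamma (t / k)"
    by (auto intro!: nonnegative_absolutely_integrable_1 simp: has_integral_iff)
  then have "(\<lambda>x. \<bar>x powr (k - 1)\<bar> * ?f (?g x)) absolutely_integrable_on {0<..} \<and>
      integral {0<..} (\<lambda>x. \<bar>x powr (k - 1)\<bar> * ?f (?g x)) = Gamma (t / k)"
    using has_absolute_integral_change_of_variables_1'[OF _ deriv inj, of ?f "Gamma (t / k)"]
    by (simp add: img)
  then have "((\<lambda>x. \<bar>x powr (k - 1)\<bar> * ?f (?g x)) has_integral Gamma (t / k)) {0<..}"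
    by (metis (no_types, lifting) has_integral_iff set_lebesgue_integral_eq_integral(1))
  \<comment> \<open>The constant cancels the denominator that arises from raising
    \<open>x powr k / k\<close> to the power \<open>t / k - 1\<close>.\<close>
  then have "((\<lambda>x. k powr (t / k - 1) * (\<bar>x powr (k - 1)\<bar> * ?f (?g x))) has_integral
      k powr (t / k - 1) * Gamma (t / k)) {0<..}"
    by (rule has_integral_mult_right)
  also have "?this \<longleftrightarrow> ((\<lambda>x. exp (- (x powr k / k)) * x powr (t - 1)) has_integral
      k powr (t / k - 1) * Gamma (t / k)) {0<..}"
  proof (rule has_integral_cong)
    fix x :: real assume "x \<in> {0<..}"
    then have x: "x > 0" by simp
    have "?g x powr (t / k - 1) = x powr (t - k) / k powr (t / k - 1)"
      using k x by (simp add: powr_divide powr_powr right_diff_distrib)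
    moreover have "x powr (k - 1) * x powr (t - k) = x powr (t - 1)"
      by (simp flip: powr_add)
    ultimately show "k powr (t / k - 1) * (\<bar>x powr (k - 1)\<bar> * ?f (?g x)) =
        exp (- (x powr k / k)) * x powr (t - 1)"
      using k by (simp add: exp_minus divide_inverse mult_ac)
  qed
  finally show ?thesis
    unfolding k_Gamma_def int_open by (rule integral_unique)
qed

lemma k_Gamma_pos: "k > 0 \<Longrightarrow> t > 0 \<Longrightarrow> k_Gamma k t > 0"
  by (simp add: k_Gamma_conv_Gamma)

text \<open>The logarithm of the closed form is an affine term plus \<open>ln_Gamma (s / k)\<close>,
  whose derivative is known. The closed form is available only for s > 0, so the two functions are
  identified just near \<open>t\<close>, which is enough for the derivative there.\<close>

lemma has_field_derivative_ln_k_Gamma: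
  assumes k: "k > 0" and t: "t > 0"
  shows "((\<lambda>s. ln (k_Gamma k s)) has_field_derivative (ln k + Digamma (t / k)) / k) (at t)"
proof -
  have "((\<lambda>s. (s / k - 1) * ln k + ln_Gamma (s / k)) has_field_derivative
      (ln k + Digamma (t / k)) / k) (at t)"
    using k t by (auto intro!: derivative_eq_intros simp: field_simps)
  moreover have "\<forall>\<^sub>F s in nhds t. (s / k - 1) * ln k + ln_Gamma (s / k) = ln (k_Gamma k s)"
    using eventually_nhds_in_open[of "{0<..}" t]
  proof (rule eventually_mono)
    fix s :: real assume "s \<in> {0<..}"
    then have s: "s > 0" by simp
    then have "Gamma (s / k) \<noteq> 0"
      using k by (intro less_imp_neq[symmetric] Gamma_real_pos divide_pos_pos)
    with s show "(s / k - 1) * ln k + ln_Gamma (s / k) = ln (k_Gamma k s)"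
      using k by (simp add: k_Gamma_conv_Gamma ln_mult ln_Gamma_real_pos)
  qed (use t in auto)
  ultimately show ?thesis
    by (simp add: DERIV_cong_ev)
qed

lemma k_psi_conv_Digamma:
  "k > 0 \<Longrightarrow> t > 0 \<Longrightarrow> k_psi k t = (ln k + Digamma (t / k)) / k"
  unfolding k_psi_def by (intro DERIV_imp_deriv has_field_derivative_ln_k_Gamma)

lemma k_psi_mono:
  assumes "k > 0" "0 < s" "s \<le> t"
  shows "k_psi k s \<le> k_psi k t"
  using assms by (auto simp: k_psi_conv_Digamma intro!: divide_right_mono Digamma_real_mono)

lemma has_field_derivative_ln_k_Gamma_affine:
  assumes "k > 0" "c * t + d > 0"
  shows "((\<lambda>s. ln (k_Gamma k (c * s + d))) has_field_derivative c * k_psi k (c * t + d)) (at t)"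
proof -
  have "((\<lambda>s. c * s + d) has_field_derivative c) (at t)"
    by (auto intro!: derivative_eq_intros)
  from DERIV_chain2[OF has_field_derivative_ln_k_Gamma[OF assms] this] show ?thesis
    using assms by (simp add: k_psi_conv_Digamma mult.commute)
qed

text \<open>This treats a single factor of the product. Passing to logarithms turns the quotient
  into a difference whose derivative has a visible sign.\<close>

lemma k_Gamma_quotient_antimono:
  fixes k a b \<alpha> \<beta> s t :: real
  assumes k: "k > 0" and ab: "0 < a" "a \<le> b"
    and le: "\<And>u. u \<in> {s..t} \<Longrightarrow> a * u + \<alpha> \<le> b * u + \<beta>"
    and pos: "\<And>u. u \<in> {s..t} \<Longrightarrow> a * u + \<alpha> > 0"
    and psi: "\<And>u. u \<in> {s..t} \<Longrightarrow> k_psi k (a * u + \<alpha>) > 0"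
    and st: "s \<le> t"
  shows "k_Gamma k (a * t + \<alpha>) / k_Gamma k (b * t + \<beta>) \<le>
         k_Gamma k (a * s + \<alpha>) / k_Gamma k (b * s + \<beta>)"
proof -
  have posb: "b * u + \<beta> > 0" if "u \<in> {s..t}" for u
    using le[OF that] pos[OF that] by linarith
  let ?F = "\<lambda>u. ln (k_Gamma k (a * u + \<alpha>)) - ln (k_Gamma k (b * u + \<beta>))"
  have "?F t \<le> ?F s"
  proof (rule DERIV_nonpos_imp_nonincreasing[OF st])
    fix u assume "s \<le> u" "u \<le> t"
    then have u: "u \<in> {s..t}" by simp
    have "(?F has_field_derivative
        a * k_psi k (a * u + \<alpha>) - b * k_psi k (b * u + \<beta>)) (at u)"
      by (intro DERIV_diff has_field_derivative_ln_k_Gamma_affine k pos[OF u] posb[OF u])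
    \<comment> \<open>Multiplying the inequalities a \<le> b and \<psi>(au + \<alpha>) \<le>
      \<psi>(bu + \<beta>) is legitimate because b and the smaller \<psi>-value are
      positive.\<close>
    moreover have "a * k_psi k (a * u + \<alpha>) \<le> b * k_psi k (b * u + \<beta>)"
      using ab psi[OF u] k_psi_mono[OF k pos[OF u] le[OF u]] by (intro mult_mono) auto
    ultimately show "\<exists>y. (?F has_field_derivative y) (at u) \<and> y \<le> 0"
      by (intro exI conjI) auto
  qed
  moreover have "exp (?F u) = k_Gamma k (a * u + \<alpha>) / k_Gamma k (b * u + \<beta>)"
    if "u \<in> {s..t}" for u
    using k_Gamma_pos[OF k pos[OF that]] k_Gamma_pos[OF k posb[OF that]] by (simp add: exp_diff)
  ultimately show ?thesis
    using st by (metis atLeastAtMost_iff exp_le_cancel_iff order_refl)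
qed

theorem theorem3p7:
  fixes k a b :: real and n :: nat and \<alpha> \<beta> :: "nat \<Rightarrow> real" and X :: "real \<Rightarrow> real"
  assumes "k > 0"
    and "n \<ge> 1"
    and "0 < a" and "a \<le> b"
    and "\<And>i. i \<in> {1..n} \<Longrightarrow> \<alpha> i > 0"
    and "\<And>i. i \<in> {1..n} \<Longrightarrow> \<beta> i > 0"
    and "\<And>i t. i \<in> {1..n} \<Longrightarrow> t \<in> {0..} \<Longrightarrow> a * t + \<alpha> i > 0"
    and "\<And>i t. i \<in> {1..n} \<Longrightarrow> t \<in> {0..} \<Longrightarrow> b * t + \<beta> i > 0"
    and "\<And>i t. i \<in> {1..n} \<Longrightarrow> t \<in> {0..} \<Longrightarrow> a * t + \<alpha> i \<le> b * t + \<beta> i"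
    and "\<And>i t. i \<in> {1..n} \<Longrightarrow> t \<in> {0..} \<Longrightarrow> k_psi k (a * t + \<alpha> i) > 0"
    and "\<And>t. t \<in> {0..} \<Longrightarrow>
           X t = (\<Prod>i=1..n. k_Gamma k (a * t + \<alpha> i) / k_Gamma k (b * t + \<beta> i))"
  shows "antimono_on {0..} X \<and>
         (\<forall>t\<in>{0..1}.
            (\<Prod>i=1..n. k_Gamma k (a + \<alpha> i) / k_Gamma k (b + \<beta> i))
              \<le> (\<Prod>i=1..n. k_Gamma k (a * t + \<alpha> i) / k_Gamma k (b * t + \<beta> i)) \<and>
            (\<Prod>i=1..n. k_Gamma k (a * t + \<alpha> i) / k_Gamma k (b * t + \<beta> i))
              \<le> (\<Prod>i=1..n. k_Gamma k (\<alpha> i) / k_Gamma k (\<beta> i)))"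
proof -
  let ?P = "\<lambda>t. \<Prod>i=1..n. k_Gamma k (a * t + \<alpha> i) / k_Gamma k (b * t + \<beta> i)"
  have anti: "?P t \<le> ?P s" if "0 \<le> s" "s \<le> t" for s t
  proof (rule prod_mono, intro conjI)
    fix i assume i: "i \<in> {1..n}"
    \<comment> \<open>Factorwise inequalities multiply only if the smaller factors are
      nonnegative.\<close>
    show "0 \<le> k_Gamma k (a * t + \<alpha> i) / k_Gamma k (b * t + \<beta> i)"
      using that i assms(1,7,8) by (intro divide_nonneg_nonneg less_imp_le k_Gamma_pos) auto
    show "k_Gamma k (a * t + \<alpha> i) / k_Gamma k (b * t + \<beta> i) \<le>
        k_Gamma k (a * s + \<alpha> i) / k_Gamma k (b * s + \<beta> i)"
      by (rule k_Gamma_quotient_antimono) (use that i assms in auto)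
  qed
  have "antimono_on {0..} X"
    using anti assms(11) by (intro monotone_onI) simp
  \<comment> \<open>The outer products in the claimed bounds are the values of \<open>?P\<close> at
    the endpoints 1 and 0.\<close>
  moreover have "?P 1 \<le> ?P t \<and> ?P t \<le> ?P 0" if "t \<in> {0..1}" for t
    using that anti[of t 1] anti[of 0 t] by simp
  ultimately show ?thesis by simp
qed

end
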